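(* Let $\mathbf{X}_1,\dots,\mathbf{X}_n$ be taken from a strictly stationary sequence of $[0,\infty)^d$-valued random vectors with twice continuously differentiable marginal density $f$. Let $\widehat f$ be the product gamma kernel estimator with $b_1=b_2=\dots=b_d=b$, where $b\to 0$ as $n\to\infty$. Then, at a point $x_1^d$ with $x_j>0$ for all $j$ (so that $x_j\ge 2b$ for all $j$ once $n$ is large), $$Bias(\widehat f(x_1^d))=\mathsf E\widehat f(x_1^d)-f(x_1^d)=\frac b2\sum_{j=1}^dx_j\frac{\partial^2f(x_1^d)}{\partial x_j^2}+o(b).$$
   Context: Notation: $x_1^d=(x_1,\dots,x_d)$; $\mathbf{X}_i=(X_{i1},\dots,X_{id})^T$. The gamma kernel is $K_{\rho,b}(t)=\dfrac{t^{\rho-1}e^{-t/b}}{b^{\rho}\Gamma(\rho)}$, $t\geq 0$, with $\rho=\rho(x,b)=x/b$ if $x\ge 2b$ and $\rho(x,b)=(x/(2b))^2+1$ if $x\in[0,2b)$. The estimator is $\widehat f(x_1^d)=\frac1n\sum_{i=1}^n\prod_{j=1}^dK_{\rho(x_j,b),b}(X_{ij})$. *)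

theory Defs
  imports "HOL-Probability.Probability" "HOL-Library.Landau_Symbols"
begin

definition nonneg_orthant :: "(real ^ 'd) set" where
  "nonneg_orthant = {x. \<forall>j. 0 \<le> x $ j}"

text \<open>Derivatives are taken within \<open>S\<close>, so they are one-sided at boundary points of \<open>S\<close>. They are
  unique if \<open>S\<close> is convex with nonempty interior, as the orthant is.\<close>

definition twice_cont_diff_on :: "('a::real_normed_vector \<Rightarrow> real) \<Rightarrow> 'a set \<Rightarrow> bool" where
  "twice_cont_diff_on f S \<longleftrightarrow>
    (\<exists>(f' :: 'a \<Rightarrow> 'a \<Rightarrow>\<^sub>L real) (f'' :: 'a \<Rightarrow> 'a \<Rightarrow>\<^sub>L 'a \<Rightarrow>\<^sub>L real).
      (\<forall>x\<in>S. (f has_derivative blinfun_apply (f' x)) (at x within S)) \<and>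
      (\<forall>x\<in>S. (f' has_derivative blinfun_apply (f'' x)) (at x within S)) \<and>
      continuous_on S f'')"

definition partial_deriv :: "'d \<Rightarrow> (real ^ 'd \<Rightarrow> real) \<Rightarrow> real ^ 'd \<Rightarrow> real" where
  "partial_deriv j f x = deriv (\<lambda>s. f (\<chi> i. if i = j then s else x $ i)) (x $ j)"

text \<open>Invariance of all finite-dimensional distributions under time shifts.\<close>

definition strictly_stationary :: "'w measure \<Rightarrow> (nat \<Rightarrow> 'w \<Rightarrow> 'a::topological_space) \<Rightarrow> bool" where
  "strictly_stationary M X \<longleftrightarrow>
    (\<forall>i. X i \<in> borel_measurable M) \<and>
    (\<forall>I h. finite I \<longrightarrow>
      distr M (\<Pi>\<^sub>M i\<in>I. borel) (\<lambda>\<omega>. \<lambda>i\<in>I. X (i + h) \<omega>) =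
      distr M (\<Pi>\<^sub>M i\<in>I. borel) (\<lambda>\<omega>. \<lambda>i\<in>I. X i \<omega>))"

definition gamma_shape :: "real \<Rightarrow> real \<Rightarrow> real" where
  "gamma_shape x b = (if x \<ge> 2 * b then x / b else (x / (2 * b))\<^sup>2 + 1)"

text \<open>The kernel is meant for \<open>t \<ge> 0\<close> only. Since \<open>0 powr 0 = 0\<close>, the formula deviates from the
  convention \<open>0\<^sup>0 = 1\<close> at \<open>t = 0\<close>, \<open>\<rho> = 1\<close>; for the shapes \<open>gamma_shape x b\<close> with \<open>b > 0\<close> and \<open>x \<ge> 0\<close>
  this only concerns \<open>x = 0\<close>.\<close>

definition gamma_kernel :: "real \<Rightarrow> real \<Rightarrow> real \<Rightarrow> real" where
  "gamma_kernel \<rho> b t = t powr (\<rho> - 1) * exp (- t / b) / (b powr \<rho> * Gamma \<rho>)"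

text \<open>The sample \<open>X\<^sub>1, \<dots>, X\<^sub>n\<close> is indexed from zero, as \<open>X 0, \<dots>, X (n - 1)\<close>.\<close>

definition gamma_kde ::
  "(nat \<Rightarrow> 'w \<Rightarrow> real ^ 'd) \<Rightarrow> nat \<Rightarrow> real \<Rightarrow> real ^ 'd \<Rightarrow> 'w \<Rightarrow> real" where
  "gamma_kde X n b x \<omega> =
    1 / real n * (\<Sum>i<n. \<Prod>j\<in>UNIV. gamma_kernel (gamma_shape (x $ j) b) b (X i \<omega> $ j))"

end

theory Submission
  imports Defs
begin

text \<open>By stationarity, the expectation of the estimator is the integral of \<open>f\<close> against the product \<open>k\<close> of the
  gamma densities with shape \<open>x\<^sub>j / b\<close> and scale \<open>b\<close>. The factors have mean \<open>x\<^sub>j\<close> and variance \<open>x\<^sub>j b\<close>, so the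
  integral of the second order Taylor polynomial \<open>T\<close> of \<open>f\<close> at \<open>x\<close> against \<open>k\<close> is exactly \<open>f(x)\<close> plus
  the claimed leading term. The remainder \<open>f - T\<close> is at most \<open>\<epsilon> |y - x|\<^sup>2\<close> near \<open>x\<close>, which contributes
  \<open>\<epsilon> O(b)\<close>. Away from \<open>x\<close>, where nothing is known about \<open>f\<close> except that it is integrable, \<open>k\<close>
  is exponentially small in \<open>1 / b\<close>, while \<open>T\<close> is dominated by a multiple of \<open>|y - x|\<^sup>4\<close>, whose
  integral against \<open>k\<close> is \<open>O(b\<^sup>2)\<close>.\<close>

subsection \<open>Gamma densities: moments and exponential decay\<close>

text \<open>The formula of \<open>gamma_kernel\<close> is meant for nonnegative arguments only.
  Cutting it off at 0 gives a function on the whole line, to be integrated against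
  \<open>lborel\<close>.\<close>

definition gamma_density :: "real \<Rightarrow> real \<Rightarrow> real \<Rightarrow> real" where
  "gamma_density \<rho> b t = indicator {0..} t * gamma_kernel \<rho> b t"

lemma borel_measurable_gamma_kernel [measurable]: "gamma_kernel \<rho> b \<in> borel_measurable borel"
  unfolding gamma_kernel_def by measurable

lemma borel_measurable_gamma_density [measurable]: "gamma_density \<rho> b \<in> borel_measurable borel"
  unfolding gamma_density_def by measurable

lemma gamma_density_nonneg: "0 < \<rho> \<Longrightarrow> 0 < b \<Longrightarrow> 0 \<le> gamma_density \<rho> b t"
  using Gamma_real_pos[of \<rho>] by (simp add: gamma_density_def gamma_kernel_def)

text \<open>Multiplying by \<open>t ^ k\<close> raises the shape from \<rho> to \<rho> + k.
  Rescaling by b reduces the integral to Euler's integral for \<open>Gamma\<close>, and the quotient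
  of the two Gamma values is a Pochhammer symbol.\<close>

lemma gamma_density_moment:
  assumes "0 < \<rho>" "0 < b"
  shows "has_bochner_integral lborel (\<lambda>t. gamma_density \<rho> b t * t ^ k) (b ^ k * pochhammer \<rho> k)"
proof -
  define s where "s = \<rho> + real k"
  have s: "0 < s" using assms by (simp add: s_def)
  have \<Gamma>: "Gamma \<rho> > 0" using assms by (simp add: Gamma_real_pos)
  have "has_bochner_integral lborel (\<lambda>t. indicator {0..} t * t powr (s - 1) / exp t) (Gamma s)"
    using s Gamma_conv_nn_integral_real[OF s]
    by (intro has_bochner_integral_nn_integral) (auto simp: Gamma_real_nonneg Gamma_real_pos less_imp_le)
  then have "has_bochner_integral lborel
      (\<lambda>t. indicator {0..} (0 + (1 / b) * t) * (0 + (1 / b) * t) powr (s - 1) / exp (0 + (1 / b) * t))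
      (Gamma s /\<^sub>R \<bar>1 / b\<bar>)"
    using assms by (subst (asm) lborel_has_bochner_integral_real_affine_iff[of "1 / b" _ _ 0]) auto
  \<comment> \<open>The substitution multiplied the integral by b; the new prefactor cancels this
    and supplies \<open>b ^ k\<close> and the normalisation by \<open>Gamma \<rho>\<close>.\<close>
  then have "has_bochner_integral lborel
      (\<lambda>t. b ^ k / (b * Gamma \<rho>) *
        (indicator {0..} (0 + (1 / b) * t) * (0 + (1 / b) * t) powr (s - 1) / exp (0 + (1 / b) * t)))
      (b ^ k / (b * Gamma \<rho>) * (Gamma s /\<^sub>R \<bar>1 / b\<bar>))"
    by (rule has_bochner_integral_mult_right)
  also have "b ^ k / (b * Gamma \<rho>) * (Gamma s /\<^sub>R \<bar>1 / b\<bar>) = b ^ k * pochhammer \<rho> k"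
  proof -
    have "\<rho> \<notin> \<int>\<^sub>\<le>\<^sub>0" using assms by (auto elim!: nonpos_Ints_cases)
    then show ?thesis using assms \<Gamma> by (simp add: pochhammer_Gamma s_def field_simps)
  qed
  also have "(\<lambda>t. b ^ k / (b * Gamma \<rho>) *
        (indicator {0..} (0 + (1 / b) * t) * (0 + (1 / b) * t) powr (s - 1) / exp (0 + (1 / b) * t)))
      = (\<lambda>t. gamma_density \<rho> b t * t ^ k)"
  proof
    fix t :: real
    consider "t < 0" | "t = 0" | "t > 0" by linarith
    then show "b ^ k / (b * Gamma \<rho>) *
        (indicator {0..} (0 + (1 / b) * t) * (0 + (1 / b) * t) powr (s - 1) / exp (0 + (1 / b) * t))
      = gamma_density \<rho> b t * t ^ k"
    proof cases
      case 1
      then show ?thesis using assms by (simp add: gamma_density_def indicator_def field_simps)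
    next
      \<comment> \<open>Both sides are 0 here, whatever the exponents, because
        \<open>0 powr a = 0\<close> for every \<open>a\<close>.\<close>
      case 2
      then show ?thesis by (simp add: gamma_density_def gamma_kernel_def)
    next
      case 3
      have "b ^ k * (t / b) powr (s - 1) / b = t powr (\<rho> - 1) / b powr \<rho> * t ^ k"
        using 3 assms
        by (simp add: s_def powr_divide powr_add powr_diff powr_realpow field_simps)
      then have "b ^ k * (t / b) powr (s - 1) / b * (exp (- t / b) / Gamma \<rho>)
          = t powr (\<rho> - 1) / b powr \<rho> * t ^ k * (exp (- t / b) / Gamma \<rho>)"
        by simp
      then show ?thesis using 3 assms \<Gamma>
        by (simp add: gamma_density_def gamma_kernel_def exp_minus divide_inverse mult_ac)
    qed
  qed
  finally show ?thesis .
qed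

text \<open>With shape \<open>x / b\<close> the factor \<open>b ^ k\<close> clears the denominators
  of the Pochhammer symbol, so the raw moments are polynomials in x and b.\<close>

lemma gamma_density_moments:
  assumes "0 < x" "0 < b"
  defines "g \<equiv> gamma_density (x / b) b"
  shows "has_bochner_integral lborel g 1"
    and "has_bochner_integral lborel (\<lambda>t. g t * t) x"
    and "has_bochner_integral lborel (\<lambda>t. g t * t\<^sup>2) (x * (x + b))"
    and "has_bochner_integral lborel (\<lambda>t. g t * t ^ 3) (x * (x + b) * (x + 2 * b))"
    and "has_bochner_integral lborel (\<lambda>t. g t * t ^ 4) (x * (x + b) * (x + 2 * b) * (x + 3 * b))"
proof -
  have pos: "0 < x / b" using assms by simp
  note mom = gamma_density_moment[OF pos \<open>0 < b\<close>, folded g_def]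
  show "has_bochner_integral lborel g 1"
    using mom[of 0] by simp
  show "has_bochner_integral lborel (\<lambda>t. g t * t) x"
    using mom[of 1] assms by simp
  have "b ^ 2 * pochhammer (x / b) 2 = x * (x + b)"
    using assms by (simp add: eval_nat_numeral pochhammer_Suc) (simp add: field_simps)
  with mom[of 2] show "has_bochner_integral lborel (\<lambda>t. g t * t\<^sup>2) (x * (x + b))"
    by simp
  have "b ^ 3 * pochhammer (x / b) 3 = x * (x + b) * (x + 2 * b)"
    using assms by (simp add: eval_nat_numeral pochhammer_Suc) (simp add: field_simps)
  with mom[of 3] show "has_bochner_integral lborel (\<lambda>t. g t * t ^ 3) (x * (x + b) * (x + 2 * b))"
    by simp
  have "b ^ 4 * pochhammer (x / b) 4 = x * (x + b) * (x + 2 * b) * (x + 3 * b)"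
    using assms by (simp add: eval_nat_numeral pochhammer_Suc) (simp add: field_simps)
  with mom[of 4] show "has_bochner_integral lborel (\<lambda>t. g t * t ^ 4)
      (x * (x + b) * (x + 2 * b) * (x + 3 * b))"
    by simp
qed

text \<open>Binomial expansion into raw moments. The exponents 0 and 1 are spelled out so that all
  four facts share the form that \<open>prod_gamma_density_moment\<close> takes as input.\<close>

lemma gamma_density_central_moments:
  assumes "0 < x" "0 < b"
  defines "g \<equiv> gamma_density (x / b) b"
  shows "has_bochner_integral lborel (\<lambda>t. g t * (t - x) ^ 0) 1"
    and "has_bochner_integral lborel (\<lambda>t. g t * (t - x) ^ 1) 0"
    and "has_bochner_integral lborel (\<lambda>t. g t * (t - x) ^ 2) (x * b)"
    and "has_bochner_integral lborel (\<lambda>t. g t * (t - x) ^ 4) (3 * x\<^sup>2 * b\<^sup>2 + 6 * x * b ^ 3)"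
proof -
  note mom = gamma_density_moments[OF assms(1,2), folded g_def]
  show "has_bochner_integral lborel (\<lambda>t. g t * (t - x) ^ 0) 1"
    using mom(1) by simp
  have "has_bochner_integral lborel (\<lambda>t. g t * t - x * g t) (x - x * 1)"
    by (intro has_bochner_integral_diff has_bochner_integral_mult_right mom)
  then show "has_bochner_integral lborel (\<lambda>t. g t * (t - x) ^ 1) 0"
    by (simp add: algebra_simps)
  have "has_bochner_integral lborel (\<lambda>t. g t * t\<^sup>2 - (2 * x) * (g t * t) + x\<^sup>2 * g t)
      (x * (x + b) - (2 * x) * x + x\<^sup>2 * 1)"
    by (intro has_bochner_integral_diff has_bochner_integral_add has_bochner_integral_mult_right mom)
  then show "has_bochner_integral lborel (\<lambda>t. g t * (t - x) ^ 2) (x * b)"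
    by (simp add: algebra_simps power2_eq_square)
  have "has_bochner_integral lborel
      (\<lambda>t. g t * t ^ 4 - (4 * x) * (g t * t ^ 3) + (6 * x\<^sup>2) * (g t * t\<^sup>2) - (4 * x ^ 3) * (g t * t) + x ^ 4 * g t)
      (x * (x + b) * (x + 2 * b) * (x + 3 * b) - (4 * x) * (x * (x + b) * (x + 2 * b))
        + (6 * x\<^sup>2) * (x * (x + b)) - (4 * x ^ 3) * x + x ^ 4 * 1)"
    by (intro has_bochner_integral_diff has_bochner_integral_add has_bochner_integral_mult_right mom)
  also have "(\<lambda>t. g t * t ^ 4 - (4 * x) * (g t * t ^ 3) + (6 * x\<^sup>2) * (g t * t\<^sup>2) - (4 * x ^ 3) * (g t * t) + x ^ 4 * g t)
      = (\<lambda>t. g t * (t - x) ^ 4)"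
    by (rule ext) algebra
  also have "x * (x + b) * (x + 2 * b) * (x + 3 * b) - (4 * x) * (x * (x + b) * (x + 2 * b))
        + (6 * x\<^sup>2) * (x * (x + b)) - (4 * x ^ 3) * x + x ^ 4 * 1 = 3 * x\<^sup>2 * b\<^sup>2 + 6 * x * b ^ 3"
    by algebra
  finally show "has_bochner_integral lborel (\<lambda>t. g t * (t - x) ^ 4) (3 * x\<^sup>2 * b\<^sup>2 + 6 * x * b ^ 3)" .
qed

section \<open>Pointwise bounds: decay of the gamma density away from its mean\<close>

text \<open>A one-sided Stirling bound: keep only the part of Euler's integral beyond \<rho>, where
  the power, having a nonnegative exponent, is at least its value at \<rho>.\<close>

lemma Gamma_real_lower_bound:
  assumes "1 \<le> (\<rho>::real)"
  shows "\<rho> powr (\<rho> - 1) * exp (- \<rho>) \<le> Gamma \<rho>"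
proof (rule has_integral_le)
  have "((\<lambda>t. \<rho> powr (\<rho> - 1) * exp (- 1 * t)) has_integral \<rho> powr (\<rho> - 1) * (exp (- 1 * \<rho>) / 1)) {\<rho>..}"
    by (intro has_integral_mult_right has_integral_exp_minus_to_infinity) simp
  then show "((\<lambda>t. if t \<in> {\<rho>..} then \<rho> powr (\<rho> - 1) * exp (- t) else 0)
      has_integral \<rho> powr (\<rho> - 1) * exp (- \<rho>)) {0..}"
    using assms by (subst has_integral_restrict) auto
  show "((\<lambda>t. t powr (\<rho> - 1) / exp t) has_integral Gamma \<rho>) {0..}"
    using assms by (intro Gamma_integral_real) auto
  show "(if t \<in> {\<rho>..} then \<rho> powr (\<rho> - 1) * exp (- t) else 0) \<le> t powr (\<rho> - 1) / exp t" for t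
    using assms by (auto simp: exp_minus field_simps intro!: powr_mono2)
qed

text \<open>This is \<open>ln v \<le> v - 1\<close> at \<open>v = sqrt u\<close>. It improves on the
  same inequality at u by exactly the square of \<open>sqrt u - 1\<close>.\<close>

lemma ln_le_sqrt: "0 < u \<Longrightarrow> ln u \<le> 2 * (sqrt u - 1)"
  using ln_le_minus_one[of "sqrt u"] by (simp add: ln_sqrt)

text \<open>With u = t / x, the Stirling bound on the normalisation leaves an exponent of order 1 /
  b times \<open>ln u + 1 - u\<close>, which vanishes at u = 1 and is negative elsewhere.\<close>

lemma gamma_density_le:
  assumes "0 < b" "b \<le> x"
  shows "gamma_density (x / b) b t \<le> exp 1 / b * exp (- ((x / b - 1) * (sqrt (t / x) - 1)\<^sup>2))"
proof (cases "t \<le> 0")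
  case True
  then show ?thesis using assms by (cases "t = 0") (auto simp: gamma_density_def gamma_kernel_def)
next
  case False
  define u where "u = t / x"
  define \<rho> where "\<rho> = x / b"
  have \<rho>: "1 \<le> \<rho>" "x = b * \<rho>" and u: "0 < u" and t: "t = b * \<rho> * u"
    using assms False by (auto simp: \<rho>_def u_def field_simps)
  have "gamma_density \<rho> b t = t powr (\<rho> - 1) * exp (- t / b) / (b powr \<rho> * Gamma \<rho>)"
    using False by (simp add: gamma_density_def gamma_kernel_def)
  also have "\<dots> \<le> t powr (\<rho> - 1) * exp (- t / b) / (b powr \<rho> * (\<rho> powr (\<rho> - 1) * exp (- \<rho>)))"
    using \<rho> assms Gamma_real_lower_bound[OF \<rho>(1)] Gamma_real_pos[of \<rho>]
    by (intro divide_left_mono mult_left_mono mult_pos_pos) auto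
  also have "\<dots> = 1 / b * (u powr (\<rho> - 1) * exp (\<rho> * (1 - u)))"
    using \<rho> assms u unfolding t
    by (simp add: powr_mult powr_diff exp_minus exp_diff right_diff_distrib field_simps)
  \<comment> \<open>The power carries \<rho> - 1 but the exponential \<rho>. The leftover
    \<open>1 - u\<close>, at most 1, is the origin of the factor \<open>exp 1\<close>.\<close>
  also have "u powr (\<rho> - 1) * exp (\<rho> * (1 - u)) = exp ((\<rho> - 1) * (ln u + 1 - u) + (1 - u))"
    using u by (simp add: powr_def flip: exp_add) (simp add: algebra_simps)
  \<comment> \<open>\<open>ln u \<le> 2 (sqrt u - 1)\<close> turns the exponent into a negative square.\<close>
  also have "1 / b * exp ((\<rho> - 1) * (ln u + 1 - u) + (1 - u))
      \<le> 1 / b * (exp 1 * exp (- ((\<rho> - 1) * (sqrt u - 1)\<^sup>2)))"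
  proof -
    have "ln u + 1 - u \<le> - (sqrt u - 1)\<^sup>2"
      using ln_le_sqrt[OF u] u by (simp add: power2_eq_square algebra_simps)
    then have "(\<rho> - 1) * (ln u + 1 - u) \<le> (\<rho> - 1) * (- (sqrt u - 1)\<^sup>2)"
      using \<rho> by (intro mult_left_mono) auto
    then show ?thesis using u assms
      by (intro mult_left_mono) (simp_all flip: exp_add)
  qed
  finally show ?thesis
    by (simp add: \<rho>_def u_def)
qed

text \<open>Factor \<open>u - 1\<close> as \<open>(sqrt u - 1) * (sqrt u + 1)\<close>. Below
  \<open>sqrt u = 2\<close> the second factor is less than 3; from there on
  \<open>sqrt u - 1\<close> is at least 1, hence the minimum.\<close>

lemma sqrt_minus_one_lower_bound:
  assumes "0 \<le> u" "\<eta> \<le> \<bar>u - 1\<bar>" "0 < \<eta>"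
  shows "(min 1 \<eta> / 3)\<^sup>2 \<le> (sqrt u - 1)\<^sup>2"
proof -
  have "u - 1 = (sqrt u - 1) * (sqrt u + 1)"
    using assms by (simp add: algebra_simps)
  then have eq: "\<bar>u - 1\<bar> = \<bar>sqrt u - 1\<bar> * (sqrt u + 1)"
    using assms by (simp only: abs_mult) simp
  have "min 1 \<eta> / 3 \<le> \<bar>sqrt u - 1\<bar>"
  proof (cases "sqrt u \<ge> 2")
    case True
    then show ?thesis using assms by linarith
  next
    case False
    then have "\<bar>sqrt u - 1\<bar> * (sqrt u + 1) \<le> \<bar>sqrt u - 1\<bar> * 3"
      by (intro mult_left_mono) auto
    then show ?thesis using assms eq by (simp add: min_def)
  qed
  then have "\<bar>min 1 \<eta> / 3\<bar> \<le> \<bar>sqrt u - 1\<bar>" using assms by auto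
  then show ?thesis by (simp only: abs_le_square_iff)
qed

lemma gamma_density_le_const:
  assumes "0 < b" "b \<le> x"
  shows "gamma_density (x / b) b t \<le> exp 1 / b"
proof -
  have "gamma_density (x / b) b t \<le> exp 1 / b * exp (- ((x / b - 1) * (sqrt (t / x) - 1)\<^sup>2))"
    by (rule gamma_density_le[OF assms])
  also have "\<dots> \<le> exp 1 / b * 1"
    using assms by (intro mult_left_mono) auto
  finally show ?thesis by simp
qed

text \<open>The bound no longer depends on t, and for fixed x and \<delta> it is exponentially small
  in 1 / b.\<close>

lemma gamma_density_tail:
  assumes "0 < b" "b \<le> x" "0 < \<delta>" "\<delta> \<le> \<bar>t - x\<bar>"
  shows "gamma_density (x / b) b t \<le> exp 1 / b * exp (- ((x / b - 1) * (min 1 (\<delta> / x) / 3)\<^sup>2))"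
proof (cases "t < 0")
  case True
  then show ?thesis using assms by (simp add: gamma_density_def)
next
  case False
  have "\<delta> / x \<le> \<bar>t / x - 1\<bar>"
  proof -
    have "t / x - 1 = (t - x) / x" using assms by (simp add: field_simps)
    then show ?thesis using assms by (simp add: divide_right_mono)
  qed
  then have "(min 1 (\<delta> / x) / 3)\<^sup>2 \<le> (sqrt (t / x) - 1)\<^sup>2"
    using assms False by (intro sqrt_minus_one_lower_bound) auto
  then have "exp 1 / b * exp (- ((x / b - 1) * (sqrt (t / x) - 1)\<^sup>2))
      \<le> exp 1 / b * exp (- ((x / b - 1) * (min 1 (\<delta> / x) / 3)\<^sup>2))"
    using assms by (intro mult_left_mono) (auto intro!: mult_left_mono)
  with gamma_density_le[OF assms(1,2), of t] show ?thesis by linarith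
qed

subsection \<open>Second order Taylor expansion\<close>

text \<open>The mean value theorem along the segment from x to y turns the remainder into an
  increment of \<open>f'\<close> minus its linear part, which is small by differentiability of
  \<open>f'\<close> at x.\<close>

lemma taylor_second_order_peano:
  fixes f :: "'a::real_normed_vector \<Rightarrow> real" and f' :: "'a \<Rightarrow> 'a \<Rightarrow>\<^sub>L real"
  assumes U: "open U" "x \<in> U"
    and f: "\<And>y. y \<in> U \<Longrightarrow> (f has_derivative blinfun_apply (f' y)) (at y)"
    and f': "(f' has_derivative blinfun_apply H) (at x)"
    and "0 < \<epsilon>"
  shows "\<exists>\<delta>>0. \<forall>y. norm (y - x) < \<delta> \<longrightarrow>
    \<bar>f y - (f x + f' x (y - x) + H (y - x) (y - x) / 2)\<bar> \<le> \<epsilon> * (norm (y - x))\<^sup>2"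
proof -
  obtain d1 where d1: "0 < d1"
    "\<And>y. norm (y - x) < d1 \<Longrightarrow> norm (f' y - f' x - H (y - x)) \<le> \<epsilon> * norm (y - x)"
    using f' \<open>0 < \<epsilon>\<close> unfolding has_derivative_at_alt by blast
  obtain d2 where d2: "0 < d2" "ball x d2 \<subseteq> U"
    using U openE by blast
  have "\<bar>f y - (f x + f' x (y - x) + H (y - x) (y - x) / 2)\<bar> \<le> \<epsilon> * (norm (y - x))\<^sup>2"
    if y: "norm (y - x) < min d1 d2" for y
  proof -
    define v where "v = y - x"
    \<comment> \<open>Restricting to a line avoids the symmetry of \<open>H\<close>.\<close>
    define h where "h t = f (x + t *\<^sub>R v) - t * f' x v - t\<^sup>2 / 2 * H v v" for t :: real
    have small: "norm (t *\<^sub>R v) \<le> norm v" if "0 \<le> t" "t \<le> 1" for t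
      using that by (simp add: mult_left_le_one_le)
    have der: "(h has_real_derivative (f' (x + t *\<^sub>R v) v - f' x v - t * H v v)) (at t)"
      if t: "0 \<le> t" "t \<le> 1" for t
    proof -
      have "norm (t *\<^sub>R v) < d2" using small[OF t] y by (simp add: v_def)
      then have "x + t *\<^sub>R v \<in> U" using d2 by (auto simp: dist_norm)
      note f = f[OF this]
      have "((\<lambda>t. x + t *\<^sub>R v) has_derivative (\<lambda>s. s *\<^sub>R v)) (at t)"
        by (auto intro!: derivative_eq_intros)
      from has_derivative_compose[OF this f]
      have "((\<lambda>t. f (x + t *\<^sub>R v)) has_real_derivative f' (x + t *\<^sub>R v) v) (at t)"
        by (simp add: has_field_derivative_def blinfun.scaleR_right mult_commute_abs)
      then show ?thesis
        unfolding h_def by (auto intro!: derivative_eq_intros)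
    qed
    obtain z where z: "0 < z" "z < 1" and "h 1 - h 0 = (1 - 0) * (f' (x + z *\<^sub>R v) v - f' x v - z * H v v)"
      using MVT2[of 0 1 h, OF _ der] by auto
    then have "f y - (f x + f' x v + H v v / 2) = (f' (x + z *\<^sub>R v) - f' x - H (z *\<^sub>R v)) v"
      by (simp add: h_def v_def blinfun.diff_left blinfun.scaleR_right blinfun.scaleR_left)
    also have "\<bar>\<dots>\<bar> \<le> norm (f' (x + z *\<^sub>R v) - f' x - H (z *\<^sub>R v)) * norm v"
      using norm_blinfun[of "f' (x + z *\<^sub>R v) - f' x - H (z *\<^sub>R v)" v] by simp
    also have "\<dots> \<le> (\<epsilon> * norm (z *\<^sub>R v)) * norm v"
      using d1(2)[of "x + z *\<^sub>R v"] small[of z] y z by (intro mult_right_mono) (auto simp: v_def)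
    also have "\<dots> \<le> (\<epsilon> * norm v) * norm v"
      using small[of z] z \<open>0 < \<epsilon>\<close> by (intro mult_right_mono mult_left_mono) auto
    finally show ?thesis by (simp add: v_def power2_eq_square)
  qed
  then show ?thesis using d1 d2 by (intro exI[of _ "min d1 d2"]) auto
qed

lemma partial_deriv_eq:
  fixes f :: "real ^ 'd \<Rightarrow> real"
  assumes "(f has_derivative f') (at y)"
  shows "partial_deriv j f y = f' (axis j 1)"
proof -
  have eq: "(\<chi> i. if i = j then s else y $ i) = y + (s - y $ j) *\<^sub>R axis j 1" for s
    by (simp add: vec_eq_iff axis_def)
  have "((\<lambda>s. y + (s - y $ j) *\<^sub>R axis j 1) has_derivative (\<lambda>s. s *\<^sub>R axis j 1)) (at (y $ j))"
    by (auto intro!: derivative_eq_intros)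
  moreover have "(f has_derivative f') (at (y + (y $ j - y $ j) *\<^sub>R axis j 1))"
    using assms by simp
  ultimately have "((\<lambda>s. f (y + (s - y $ j) *\<^sub>R axis j 1)) has_derivative (\<lambda>s. f' (s *\<^sub>R axis j 1))) (at (y $ j))"
    by (rule has_derivative_compose)
  moreover have "f' (s *\<^sub>R axis j 1) = f' (axis j 1) * s" for s
    using linear_scale[OF has_derivative_linear[OF assms]] by simp
  ultimately show ?thesis
    unfolding partial_deriv_def eq by (intro DERIV_imp_deriv) (simp add: has_field_derivative_def)
qed

text \<open>On U the inner partial derivative is \<open>f'\<close> applied to a basis vector; as U
  is open, this identity may be differentiated at x. It links the iterated partial derivatives to
  the bilinear form of the Taylor expansion.\<close>

lemma partial_deriv_partial_deriv_eq:
  fixes f :: "real ^ 'd \<Rightarrow> real" and f' :: "real ^ 'd \<Rightarrow> (real ^ 'd) \<Rightarrow>\<^sub>L real"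
  assumes U: "open U" "x \<in> U"
    and f: "\<And>y. y \<in> U \<Longrightarrow> (f has_derivative blinfun_apply (f' y)) (at y)"
    and f': "(f' has_derivative blinfun_apply H) (at x)"
  shows "partial_deriv i (partial_deriv j f) x = H (axis i 1) (axis j 1)"
proof -
  have "((\<lambda>y. f' y (axis j 1)) has_derivative (\<lambda>v. H v (axis j 1))) (at x)"
    by (rule has_derivative_eq_rhs[OF blinfun.FDERIV[OF f' has_derivative_const]])
       (simp add: blinfun.zero_right)
  then have "(partial_deriv j f has_derivative (\<lambda>v. H v (axis j 1))) (at x)"
    by (rule has_derivative_transform_within_open[OF _ U]) (rule partial_deriv_eq[OF f, symmetric])
  then show ?thesis by (rule partial_deriv_eq)
qed

subsection \<open>Products of gamma densities\<close>

text \<open>Fubini for separated variables. Lebesgue measure on \<open>real ^ 'd\<close> is the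
  image of a product measure indexed by \<open>Basis\<close>, so the products are moved from
  \<open>'d\<close> to \<open>Basis\<close> along \<open>j \<mapsto> axis j 1\<close>.\<close>

lemma has_bochner_integral_lborel_prod_cart:
  fixes g :: "'d::finite \<Rightarrow> real \<Rightarrow> real"
  assumes g: "\<And>j. has_bochner_integral lborel (g j) (c j)"
  shows "has_bochner_integral lborel (\<lambda>y::real^'d. \<Prod>j\<in>UNIV. g j (y $ j)) (\<Prod>j\<in>UNIV. c j)"
proof -
  interpret product_sigma_finite "\<lambda>_::real^'d. lborel :: real measure" by standard
  have [measurable]: "g j \<in> borel_measurable borel" for j
    using borel_measurable_has_bochner_integral[OF g[of j]] by simp
  have bij: "bij_betw (\<lambda>j::'d. axis j (1::real)) UNIV Basis"
    by (auto simp: bij_betw_def inj_on_def axis_eq_axis Basis_vec_def)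
  have comp: "(\<Sum>b\<in>Basis. w b * b $ j) = w (axis j 1)" for w :: "real^'d \<Rightarrow> real" and j
  proof -
    have "(\<Sum>b\<in>Basis. w b * b $ j) = (\<Sum>b\<in>Basis. w b *\<^sub>R b) \<bullet> axis j 1"
      by (simp flip: cart_eq_inner_axis)
    then show ?thesis by simp
  qed
  have reindex: "(\<Prod>j\<in>UNIV. g j (w (axis j 1))) = (\<Prod>b\<in>Basis. g (axis_index b) (w b))"
    for w :: "real^'d \<Rightarrow> real"
    by (subst prod.reindex_bij_betw[OF bij, symmetric]) simp
  have int: "integrable lborel (g j)" and eq: "integral\<^sup>L lborel (g j) = c j" for j
    using g[of j] by (auto simp: has_bochner_integral_iff)
  have "has_bochner_integral (Pi\<^sub>M Basis (\<lambda>_. lborel))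
      (\<lambda>w. \<Prod>b\<in>(Basis::(real^'d) set). g (axis_index b) (w b)) (\<Prod>b\<in>(Basis::(real^'d) set). c (axis_index b))"
    unfolding has_bochner_integral_iff
    using product_integrable_prod[of "Basis :: (real^'d) set" "\<lambda>b. g (axis_index b)"]
      product_integral_prod[of "Basis :: (real^'d) set" "\<lambda>b. g (axis_index b)"]
    by (simp add: int eq)
  also have "(\<Prod>b\<in>(Basis::(real^'d) set). c (axis_index b)) = (\<Prod>j\<in>UNIV. c j)"
    by (subst prod.reindex_bij_betw[OF bij, symmetric]) simp
  finally show ?thesis
    by (subst lborel_eq, intro has_bochner_integral_distr) (simp_all add: comp reindex)
qed

lemma cart_scaleR_expansion: "(\<Sum>j\<in>UNIV. v $ j *\<^sub>R axis j 1) = (v :: real ^ 'd)"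
  using basis_expansion[of v] by (simp add: scalar_mult_eq_scaleR)

lemma power2_norm_cart: "(norm (v :: real ^ 'd))\<^sup>2 = (\<Sum>j\<in>UNIV. (v $ j)\<^sup>2)"
  by (simp add: power2_norm_eq_inner inner_vec_def flip: power2_eq_square)

text \<open>Cauchy-Schwarz for the squared coordinates. It replaces the fourth power of the norm by
  single-coordinate moments, which are known exactly.\<close>

lemma power4_norm_cart_le: "norm (v :: real ^ 'd) ^ 4 \<le> real CARD('d) * (\<Sum>j\<in>UNIV. (v $ j) ^ 4)"
proof -
  have "norm v ^ 4 = (\<Sum>j\<in>UNIV. (v $ j)\<^sup>2)\<^sup>2"
    by (simp flip: power2_norm_cart)
  also have "\<dots> \<le> (\<Sum>j\<in>UNIV. ((v $ j)\<^sup>2)\<^sup>2) * card (UNIV :: 'd set)"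
    by (rule sum_squared_le_sum_of_squares)
  finally show ?thesis by (simp add: mult.commute)
qed

lemma blinfun_cart_expansion:
  fixes L :: "(real ^ 'd) \<Rightarrow>\<^sub>L 'b::real_normed_vector"
  shows "blinfun_apply L v = (\<Sum>j\<in>UNIV. v $ j *\<^sub>R blinfun_apply L (axis j 1))"
  by (subst (1) cart_scaleR_expansion[of v, symmetric]) (simp add: blinfun.sum_right blinfun.scaleR_right)

text \<open>The shape is the branch of \<open>gamma_shape\<close> for arguments at least
  \<open>2 * b\<close>, so this is the kernel of the estimator at nonnegative observations once
  \<open>2 * b \<le> x $ j\<close> for all j.\<close>

definition prod_gamma_density :: "real ^ 'd \<Rightarrow> real \<Rightarrow> real ^ 'd \<Rightarrow> real" where
  "prod_gamma_density x b y = (\<Prod>j\<in>UNIV. gamma_density (x $ j / b) b (y $ j))"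

lemma borel_measurable_prod_gamma_density [measurable]:
  "prod_gamma_density x b \<in> borel_measurable borel"
  unfolding prod_gamma_density_def by measurable

lemma prod_gamma_density_nonneg:
  assumes "\<And>j. 0 < x $ j" "0 < b"
  shows "0 \<le> prod_gamma_density x b y"
  unfolding prod_gamma_density_def using assms by (intro prod_nonneg) (simp add: gamma_density_nonneg)

text \<open>Coordinates are independent under the product density, so the integral of a monomial
  factorises.\<close>

lemma prod_gamma_density_moment:
  fixes x :: "real ^ 'd"
  assumes "\<And>j. has_bochner_integral lborel (\<lambda>t. gamma_density (x $ j / b) b t * (t - x $ j) ^ m j) (c j)"
  shows "has_bochner_integral lborel
    (\<lambda>y. prod_gamma_density x b y * (\<Prod>j\<in>UNIV. (y $ j - x $ j) ^ m j)) (\<Prod>j\<in>UNIV. c j)"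
  using has_bochner_integral_lborel_prod_cart[OF assms]
  by (simp add: prod_gamma_density_def prod.distrib)

lemma prod_gamma_density_central_moments:
  fixes x :: "real ^ 'd"
  assumes x: "\<And>j. 0 < x $ j" and b: "0 < b"
  defines "k \<equiv> prod_gamma_density x b"
  shows "has_bochner_integral lborel k 1"
    and "has_bochner_integral lborel (\<lambda>y. k y * (y $ i - x $ i)) 0"
    and "has_bochner_integral lborel (\<lambda>y. k y * ((y $ i - x $ i) * (y $ j - x $ j)))
           (if i = j then x $ i * b else 0)"
    and "has_bochner_integral lborel (\<lambda>y. k y * (y $ i - x $ i) ^ 4)
           (3 * (x $ i)\<^sup>2 * b\<^sup>2 + 6 * x $ i * b ^ 3)"
proof -
  note mom = gamma_density_central_moments[OF x b]
  have pow: "(\<Prod>l\<in>UNIV. (y $ l - x $ l) ^ (if l = i then n else 0)) = (y $ i - x $ i) ^ n" for y i n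
    by (subst prod.remove[of _ i]) auto
  have ind: "(\<Prod>l\<in>UNIV. if l = i then c else 1) = (c::real)" for i :: 'd and c
    by simp
  show "has_bochner_integral lborel k 1"
    using prod_gamma_density_moment[of x b "\<lambda>_. 0" "\<lambda>_. 1"] mom(1) by (simp add: k_def)
  have "has_bochner_integral lborel
      (\<lambda>y. k y * (\<Prod>l\<in>UNIV. (y $ l - x $ l) ^ (if l = i then 1 else 0)))
      (\<Prod>l\<in>UNIV. if l = i then 0 else 1)"
    unfolding k_def by (rule prod_gamma_density_moment) (use mom(1,2) in auto)
  then show "has_bochner_integral lborel (\<lambda>y. k y * (y $ i - x $ i)) 0"
    by (simp add: pow ind)
  have "has_bochner_integral lborel
      (\<lambda>y. k y * (\<Prod>l\<in>UNIV. (y $ l - x $ l) ^ (if l = i then 4 else 0)))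
      (\<Prod>l\<in>UNIV. if l = i then 3 * (x $ i)\<^sup>2 * b\<^sup>2 + 6 * x $ i * b ^ 3 else 1)"
    unfolding k_def by (rule prod_gamma_density_moment) (use mom(1,4) in auto)
  then show "has_bochner_integral lborel (\<lambda>y. k y * (y $ i - x $ i) ^ 4)
           (3 * (x $ i)\<^sup>2 * b\<^sup>2 + 6 * x $ i * b ^ 3)"
    by (simp add: pow ind)
  show "has_bochner_integral lborel (\<lambda>y. k y * ((y $ i - x $ i) * (y $ j - x $ j)))
           (if i = j then x $ i * b else 0)"
  proof (cases "i = j")
    case True
    have "has_bochner_integral lborel
        (\<lambda>y. k y * (\<Prod>l\<in>UNIV. (y $ l - x $ l) ^ (if l = i then 2 else 0)))
        (\<Prod>l\<in>UNIV. if l = i then x $ i * b else 1)"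
      unfolding k_def by (rule prod_gamma_density_moment) (use mom(1,3) in auto)
    then show ?thesis using True by (simp add: pow ind power2_eq_square)
  next
    case False
    \<comment> \<open>The exponent function is a sum of two point indicators, so
      \<open>power_add\<close> splits the monomial into the two factors that \<open>pow\<close>
      evaluates.\<close>
    have "has_bochner_integral lborel
        (\<lambda>y. k y * (\<Prod>l\<in>UNIV. (y $ l - x $ l) ^ ((if l = i then 1 else 0) + (if l = j then 1 else 0))))
        (\<Prod>l\<in>UNIV. if l = i \<or> l = j then 0 else 1)"
      unfolding k_def by (rule prod_gamma_density_moment) (use mom(1,2) False in auto)
    moreover have "(\<Prod>l\<in>UNIV. if l = i \<or> l = j then 0 else 1) = (0::real)"
      by (subst prod_zero_iff) auto
    ultimately show ?thesis using False by (simp only: power_add prod.distrib pow) simp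
  qed
qed

text \<open>Expand L and H in coordinates: first central moments and mixed covariances vanish, and
  the variances \<open>x $ j * b\<close> leave half the weighted trace of H.\<close>

lemma prod_gamma_density_quadratic:
  fixes x :: "real ^ 'd" and L :: "(real ^ 'd) \<Rightarrow>\<^sub>L real" and H :: "(real ^ 'd) \<Rightarrow>\<^sub>L (real ^ 'd) \<Rightarrow>\<^sub>L real"
  assumes x: "\<And>j. 0 < x $ j" and b: "0 < b"
  shows "has_bochner_integral lborel (\<lambda>y. prod_gamma_density x b y * (a + L (y - x) + H (y - x) (y - x) / 2))
    (a + b / 2 * (\<Sum>j\<in>UNIV. x $ j * H (axis j 1) (axis j 1)))"
proof -
  define k where "k = prod_gamma_density x b"
  note mom = prod_gamma_density_central_moments[OF x b, folded k_def]
  have "has_bochner_integral lborel (\<lambda>y. a * k y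
      + (\<Sum>j\<in>UNIV. L (axis j 1) * (k y * (y $ j - x $ j)))
      + (\<Sum>i\<in>UNIV. \<Sum>j\<in>UNIV. H (axis i 1) (axis j 1) / 2 * (k y * ((y $ i - x $ i) * (y $ j - x $ j)))))
     (a * 1 + (\<Sum>j\<in>UNIV. L (axis j 1) * 0)
      + (\<Sum>i\<in>UNIV. \<Sum>j\<in>UNIV. H (axis i 1) (axis j 1) / 2 * (if i = j then x $ i * b else 0)))"
    by (intro has_bochner_integral_add has_bochner_integral_sum has_bochner_integral_mult_right mom)
  also have "(\<lambda>y. a * k y
      + (\<Sum>j\<in>UNIV. L (axis j 1) * (k y * (y $ j - x $ j)))
      + (\<Sum>i\<in>UNIV. \<Sum>j\<in>UNIV. H (axis i 1) (axis j 1) / 2 * (k y * ((y $ i - x $ i) * (y $ j - x $ j)))))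
    = (\<lambda>y. k y * (a + L (y - x) + H (y - x) (y - x) / 2))"
  proof
    fix y
    have "L (y - x) = (\<Sum>j\<in>UNIV. (y $ j - x $ j) * L (axis j 1))"
      by (subst blinfun_cart_expansion) simp
    moreover have "H (y - x) (y - x)
        = (\<Sum>i\<in>UNIV. \<Sum>j\<in>UNIV. (y $ i - x $ i) * ((y $ j - x $ j) * H (axis i 1) (axis j 1)))"
      by (subst blinfun_cart_expansion[of H])
         (simp add: blinfun.sum_left blinfun.scaleR_left, subst blinfun_cart_expansion, simp add: sum_distrib_left)
    ultimately show "a * k y
      + (\<Sum>j\<in>UNIV. L (axis j 1) * (k y * (y $ j - x $ j)))
      + (\<Sum>i\<in>UNIV. \<Sum>j\<in>UNIV. H (axis i 1) (axis j 1) / 2 * (k y * ((y $ i - x $ i) * (y $ j - x $ j))))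
      = k y * (a + L (y - x) + H (y - x) (y - x) / 2)"
      by (simp add: sum_distrib_left sum_divide_distrib distrib_left mult_ac)
  qed
  also have "a * 1 + (\<Sum>j\<in>UNIV. L (axis j 1) * 0)
      + (\<Sum>i\<in>UNIV. \<Sum>j\<in>UNIV. H (axis i 1) (axis j 1) / 2 * (if i = j then x $ i * b else 0))
      = a + b / 2 * (\<Sum>j\<in>UNIV. x $ j * H (axis j 1) (axis j 1))"
    by (simp add: sum_distrib_left mult_ac if_distrib cong: if_cong)
  finally show ?thesis by (simp add: k_def)
qed

section \<open>Uniform and tail bounds for the product density\<close>

text \<open>The bound blows up as b tends to 0, but at fixed b it makes the product with any
  integrable function integrable.\<close>

lemma prod_gamma_density_le_const:
  fixes x :: "real ^ 'd"
  assumes "0 < b" "\<And>j. b \<le> x $ j"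
  shows "prod_gamma_density x b y \<le> (exp 1 / b) ^ CARD('d)"
proof -
  have "prod_gamma_density x b y \<le> (\<Prod>j\<in>(UNIV :: 'd set). exp 1 / b)"
    unfolding prod_gamma_density_def
    using assms less_le_trans[OF assms(1) assms(2)]
    by (intro prod_mono) (auto intro!: gamma_density_le_const gamma_density_nonneg)
  then show ?thesis by simp
qed

text \<open>One distant coordinate is enough: its factor is exponentially small and the others are
  at most \<open>exp 1 / b\<close>. Summing over j makes the bound independent of which coordinate
  is distant.\<close>

lemma prod_gamma_density_tail:
  fixes x :: "real ^ 'd"
  assumes b: "0 < b" "\<And>j. b \<le> x $ j" and \<delta>: "0 < \<delta>" "\<delta> \<le> \<bar>y $ i - x $ i\<bar>"
  shows "prod_gamma_density x b y
    \<le> (\<Sum>j\<in>UNIV. (exp 1 / b) ^ CARD('d) * exp (- ((x $ j / b - 1) * (min 1 (\<delta> / x $ j) / 3)\<^sup>2)))"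
proof -
  define E where "E j = exp (- ((x $ j / b - 1) * (min 1 (\<delta> / x $ j) / 3)\<^sup>2))" for j
  have x: "0 < x $ j" for j using less_le_trans[OF b(1) b(2)] .
  have "prod_gamma_density x b y \<le> (\<Prod>j\<in>UNIV. exp 1 / b * (if j = i then E i else 1))"
    unfolding prod_gamma_density_def
  proof (intro prod_mono conjI)
    fix j
    show "0 \<le> gamma_density (x $ j / b) b (y $ j)"
      using x b by (simp add: gamma_density_nonneg)
    show "gamma_density (x $ j / b) b (y $ j) \<le> exp 1 / b * (if j = i then E i else 1)"
      using gamma_density_tail[OF b \<delta>] gamma_density_le_const[OF b] by (simp add: E_def)
  qed
  also have "\<dots> = (exp 1 / b) ^ CARD('d) * E i"
    by (simp only: prod.distrib) simp
  also have "\<dots> \<le> (\<Sum>j\<in>UNIV. (exp 1 / b) ^ CARD('d) * E j)"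
    by (rule member_le_sum) (use b in \<open>auto simp: E_def\<close>)
  finally show ?thesis by (simp add: E_def)
qed

text \<open>Put z = a x / b: after division by b the expression is a constant multiple of
  \<open>z ^ Suc n / exp z\<close>, which tends to 0 as z grows.\<close>

lemma inverse_power_times_exp_smallo:
  fixes a x :: real
  assumes "0 < a" "0 < x"
  shows "(\<lambda>b. (exp 1 / b) ^ n * exp (- ((x / b - 1) * a))) \<in> o[at_right 0](\<lambda>b. b)"
proof (rule smalloI_tendsto)
  have "filterlim (\<lambda>b. a * x * inverse b) at_top (at_right 0)"
    using assms
    by (intro filterlim_tendsto_pos_mult_at_top[OF tendsto_const _ filterlim_inverse_at_top_right]) simp
  from filterlim_compose[OF tendsto_power_div_exp_0[of "Suc n"] this]
  have "((\<lambda>b. exp 1 ^ n * exp a / (a * x) ^ Suc n * ((a * x * inverse b) ^ Suc n / exp (a * x * inverse b)))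
      \<longlongrightarrow> exp 1 ^ n * exp a / (a * x) ^ Suc n * 0) (at_right 0)"
    by (intro tendsto_mult tendsto_const)
  moreover have "\<forall>\<^sub>F b in at_right 0. exp 1 ^ n * exp a / (a * x) ^ Suc n * ((a * x * inverse b) ^ Suc n / exp (a * x * inverse b))
      = (exp 1 / b) ^ n * exp (- ((x / b - 1) * a)) / b"
    using eventually_at_right_less[of "0::real"]
  proof eventually_elim
    case (elim b)
    have "- ((x / b - 1) * a) = a - a * x * inverse b"
      by (simp add: divide_inverse algebra_simps)
    then have "exp (- ((x / b - 1) * a)) = exp a / exp (a * x * inverse b)"
      by (simp only: exp_diff)
    moreover have "(a * x * inverse b) ^ Suc n = (a * x) ^ Suc n * (1 / b ^ n / b)"
      by (simp add: power_mult_distrib field_simps)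
    moreover have "(a * x) ^ Suc n \<noteq> 0" using assms by simp
    ultimately show ?case
      by (simp add: power_divide del: power_Suc)
  qed
  ultimately show "((\<lambda>b. (exp 1 / b) ^ n * exp (- ((x / b - 1) * a)) / b) \<longlongrightarrow> 0) (at_right 0)"
    unfolding mult_zero_right by (rule Lim_transform_eventually)
  show "\<forall>\<^sub>F b in at_right 0. b \<noteq> (0::real)"
    using eventually_at_right_less[of "0::real"] by eventually_elim simp
qed

subsection \<open>Bias of gamma smoothing\<close>

text \<open>Regularity is demanded at x alone, through the Peano expansion, so that a density
  extended by 0 beyond the orthant qualifies.\<close>

lemma prod_gamma_smoothing_bias:
  fixes x :: "real ^ 'd" and F :: "real ^ 'd \<Rightarrow> real"
    and L :: "(real ^ 'd) \<Rightarrow>\<^sub>L real" and H :: "(real ^ 'd) \<Rightarrow>\<^sub>L (real ^ 'd) \<Rightarrow>\<^sub>L real"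
  assumes x: "\<And>j. 0 < x $ j"
    and F: "integrable lborel F"
    and peano: "\<And>\<epsilon>. 0 < \<epsilon> \<Longrightarrow> \<exists>\<delta>>0. \<forall>y. norm (y - x) < \<delta> \<longrightarrow>
      \<bar>F y - (F x + L (y - x) + H (y - x) (y - x) / 2)\<bar> \<le> \<epsilon> * (norm (y - x))\<^sup>2"
  shows "(\<lambda>b. (\<integral>y. prod_gamma_density x b y * F y \<partial>lborel) - F x
      - b / 2 * (\<Sum>j\<in>UNIV. x $ j * H (axis j 1) (axis j 1))) \<in> o[at_right 0](\<lambda>b. b)"
proof (rule landau_o.smallI)
  fix c :: real assume c: "0 < c"
  define T where "T y = F x + L (y - x) + H (y - x) (y - x) / 2" for y
  define S where "S = (\<Sum>j\<in>UNIV. x $ j)"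
  \<comment> \<open>The integral of \<open>(norm (y - x))\<^sup>2\<close> against the kernel is
    \<open>b * S\<close>, so the region near x costs \<open>c / 3 * b\<close>; each of the two far
    terms gets another third.\<close>
  define \<epsilon> where "\<epsilon> = c / (3 * S)"
  define I where "I = (\<integral>y. \<bar>F y\<bar> \<partial>lborel)"
  have S: "0 < S" unfolding S_def using x by (intro sum_pos) auto
  have \<epsilon>: "0 < \<epsilon>" using c S by (simp add: \<epsilon>_def)
  obtain \<delta>0 where \<delta>0: "0 < \<delta>0" "\<And>y. norm (y - x) < \<delta>0 \<Longrightarrow> \<bar>F y - T y\<bar> \<le> \<epsilon> * (norm (y - x))\<^sup>2"
    using peano[OF \<epsilon>] unfolding T_def by blast
  \<comment> \<open>"Near" means inside a box of half-width \<delta>, since the tail bound is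
    coordinatewise; by the l1 bound on the norm the box lies in the ball of radius
    \<delta>0.\<close>
  define \<delta> where "\<delta> = \<delta>0 / CARD('d)"
  have \<delta>: "0 < \<delta>" using \<delta>0 by (simp add: \<delta>_def)
  \<comment> \<open>In the far region \<open>norm (y - x) / \<delta>\<close> is at least 1, so the
    terms of degree 0, 1 and 2 can all be raised to degree 4, at the price of these powers of
    \<delta>.\<close>
  define C where "C = \<bar>F x\<bar> / \<delta> ^ 4 + norm L / \<delta> ^ 3 + norm H / \<delta>\<^sup>2"
  have C: "0 \<le> C" using \<delta> by (simp add: C_def)
  \<comment> \<open>\<open>B b\<close> is the tail bound of the kernel, and \<open>Q b\<close> below
    is the sum of its fourth central moments.\<close>
  define B where "B b = (\<Sum>j\<in>UNIV. (exp 1 / b) ^ CARD('d) *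
    exp (- ((x $ j / b - 1) * (min 1 (\<delta> / x $ j) / 3)\<^sup>2)))" for b
  define Q where "Q b = (\<Sum>j\<in>UNIV. 3 * (x $ j)\<^sup>2 * b\<^sup>2 + 6 * x $ j * b ^ 3)" for b

  have near: "\<bar>F y - T y\<bar> \<le> \<epsilon> * (norm (y - x))\<^sup>2" if "\<And>j. \<bar>y $ j - x $ j\<bar> < \<delta>" for y
  proof (rule \<delta>0)
    have "norm (y - x) \<le> (\<Sum>j\<in>UNIV. \<bar>(y - x) $ j\<bar>)" by (rule norm_le_l1_cart)
    also have "\<dots> < (\<Sum>j\<in>(UNIV :: 'd set). \<delta>)"
      using that by (intro sum_strict_mono) auto
    finally show "norm (y - x) < \<delta>0" by (simp add: \<delta>_def)
  qed
  have far: "\<bar>T y\<bar> \<le> C * norm (y - x) ^ 4" if "\<delta> \<le> \<bar>y $ i - x $ i\<bar>" for y i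
  proof -
    define r where "r = norm (y - x)"
    have r: "\<delta> \<le> r" using that component_le_norm_cart[of "y - x" i] by (simp add: r_def)
    have "\<bar>L (y - x)\<bar> \<le> norm L * r"
      using norm_blinfun[of L "y - x"] by (simp add: r_def)
    moreover have "\<bar>H (y - x) (y - x)\<bar> \<le> norm H * r * r"
    proof -
      have "\<bar>H (y - x) (y - x)\<bar> \<le> norm (H (y - x)) * r"
        using norm_blinfun[of "H (y - x)" "y - x"] by (simp add: r_def)
      also have "\<dots> \<le> norm H * r * r"
        using norm_blinfun[of H "y - x"] by (intro mult_right_mono) (simp_all add: r_def)
      finally show ?thesis .
    qed
    moreover have "0 \<le> norm H * r * r" by (simp add: r_def)
    ultimately have "\<bar>T y\<bar> \<le> \<bar>F x\<bar> + norm L * r + norm H * r * r"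
      unfolding T_def by linarith
    also have "\<dots> \<le> \<bar>F x\<bar> * (r / \<delta>) ^ 4 + norm L * r * (r / \<delta>) ^ 3 + norm H * r * r * (r / \<delta>) ^ 2"
    proof -
      have grow: "z \<le> z * (r / \<delta>) ^ n" if "0 \<le> z" for z n
        using mult_left_mono[OF one_le_power[of "r / \<delta>" n] that] r \<delta> by simp
      show ?thesis
        using r \<delta> by (intro add_mono grow) auto
    qed
    also have "\<dots> = C * r ^ 4"
    proof -
      have "\<bar>F x\<bar> * (r / \<delta>) ^ 4 = \<bar>F x\<bar> / \<delta> ^ 4 * r ^ 4"
        "norm L * r * (r / \<delta>) ^ 3 = norm L / \<delta> ^ 3 * r ^ 4"
        "norm H * r * r * (r / \<delta>)\<^sup>2 = norm H / \<delta>\<^sup>2 * r ^ 4"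
        by (simp_all add: power_divide eval_nat_numeral)
      then show ?thesis
        by (simp only: C_def distrib_right)
    qed
    finally show ?thesis by (simp add: r_def)
  qed

  have main: "\<bar>(\<integral>y. prod_gamma_density x b y * F y \<partial>lborel) - F x
      - b / 2 * (\<Sum>j\<in>UNIV. x $ j * H (axis j 1) (axis j 1))\<bar>
      \<le> \<epsilon> * (b * S) + B b * I + C * CARD('d) * Q b"
    if b: "0 < b" "\<And>j. b \<le> x $ j" for b
  proof -
    define k where "k = prod_gamma_density x b"
    have k: "0 \<le> k y" for y using prod_gamma_density_nonneg[OF x b(1)] by (simp add: k_def)
    have [measurable]: "F \<in> borel_measurable borel" "k \<in> borel_measurable borel"
      using borel_measurable_integrable[OF F] by (simp_all add: k_def)
    note mom = prod_gamma_density_central_moments[OF x b(1), folded k_def]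
    have kT: "has_bochner_integral lborel (\<lambda>y. k y * T y)
        (F x + b / 2 * (\<Sum>j\<in>UNIV. x $ j * H (axis j 1) (axis j 1)))"
      unfolding k_def T_def by (rule prod_gamma_density_quadratic[OF x b(1)])
    have kF: "integrable lborel (\<lambda>y. k y * F y)"
    proof (rule Bochner_Integration.integrable_bound)
      show "integrable lborel (\<lambda>y. (exp 1 / b) ^ CARD('d) * F y)"
        using F by simp
      show "AE y in lborel. norm (k y * F y) \<le> norm ((exp 1 / b) ^ CARD('d) * F y)"
        using k prod_gamma_density_le_const[OF b] b
        by (auto simp: abs_mult k_def intro!: mult_right_mono)
    qed simp
    have q2: "has_bochner_integral lborel (\<lambda>y. k y * (norm (y - x))\<^sup>2) (b * S)"
    proof -
      have "has_bochner_integral lborel (\<lambda>y. \<Sum>j\<in>UNIV. k y * ((y $ j - x $ j) * (y $ j - x $ j)))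
          (\<Sum>j\<in>UNIV. if j = j then x $ j * b else 0)"
        by (intro has_bochner_integral_sum mom(3))
      also have "(\<lambda>y. \<Sum>j\<in>UNIV. k y * ((y $ j - x $ j) * (y $ j - x $ j))) = (\<lambda>y. k y * (norm (y - x))\<^sup>2)"
        by (simp add: power2_norm_cart sum_distrib_left flip: power2_eq_square)
      also have "(\<Sum>j\<in>UNIV. if j = j then x $ j * b else 0) = b * S"
        by (simp add: S_def sum_distrib_left mult.commute)
      finally show ?thesis .
    qed
    have q4: "has_bochner_integral lborel (\<lambda>y. k y * (\<Sum>j\<in>UNIV. (y $ j - x $ j) ^ 4)) (Q b)"
      unfolding Q_def sum_distrib_left by (rule has_bochner_integral_sum) (rule mom(4))
    have bound: "has_bochner_integral lborel
        (\<lambda>y. \<epsilon> * (k y * (norm (y - x))\<^sup>2) + B b * \<bar>F y\<bar> + C * CARD('d) * (k y * (\<Sum>j\<in>UNIV. (y $ j - x $ j) ^ 4)))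
        (\<epsilon> * (b * S) + B b * I + C * CARD('d) * Q b)"
      using F unfolding I_def
      by (intro has_bochner_integral_add has_bochner_integral_mult_right q2 q4 has_bochner_integral_integrable) simp
    \<comment> \<open>A single majorant serves both regions because its terms are nonnegative: the
      first covers y near x, the other two bound F and T separately far from x.\<close>
    have pointwise: "\<bar>k y * F y - k y * T y\<bar>
        \<le> \<epsilon> * (k y * (norm (y - x))\<^sup>2) + B b * \<bar>F y\<bar> + C * CARD('d) * (k y * (\<Sum>j\<in>UNIV. (y $ j - x $ j) ^ 4))" for y
    proof -
      have B: "0 \<le> B b" unfolding B_def using b by (intro sum_nonneg) simp
      have nn: "0 \<le> \<epsilon> * (k y * (norm (y - x))\<^sup>2)" "0 \<le> B b * \<bar>F y\<bar>"
        "0 \<le> C * CARD('d) * (k y * (\<Sum>j\<in>UNIV. (y $ j - x $ j) ^ 4))"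
        using \<epsilon> k B C by (auto intro!: mult_nonneg_nonneg sum_nonneg)
      have abs_k: "\<bar>k y * z\<bar> = k y * \<bar>z\<bar>" for z
        using k[of y] by (simp add: abs_mult)
      show ?thesis
      proof (cases "\<exists>i. \<delta> \<le> \<bar>y $ i - x $ i\<bar>")
        case False
        then have "k y * \<bar>F y - T y\<bar> \<le> k y * (\<epsilon> * (norm (y - x))\<^sup>2)"
          using k near[of y] by (intro mult_left_mono) (auto simp: not_le)
        then have "\<bar>k y * F y - k y * T y\<bar> \<le> \<epsilon> * (k y * (norm (y - x))\<^sup>2)"
          by (simp only: abs_k mult.left_commute[of \<epsilon>] flip: right_diff_distrib)
        with nn show ?thesis by linarith
      next
        case True
        then obtain i where i: "\<delta> \<le> \<bar>y $ i - x $ i\<bar>" by blast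
        have "\<bar>k y * F y\<bar> \<le> B b * \<bar>F y\<bar>"
          unfolding abs_k using prod_gamma_density_tail[OF b \<delta> i]
          by (intro mult_right_mono) (simp_all only: k_def B_def abs_ge_zero)
        moreover have "\<bar>k y * T y\<bar> \<le> C * CARD('d) * (k y * (\<Sum>j\<in>UNIV. (y $ j - x $ j) ^ 4))"
        proof -
          have "\<bar>T y\<bar> \<le> C * (CARD('d) * (\<Sum>j\<in>UNIV. ((y - x) $ j) ^ 4))"
            by (rule order_trans[OF far[OF i] mult_left_mono[OF power4_norm_cart_le C]])
          then have "k y * \<bar>T y\<bar> \<le> k y * (C * (CARD('d) * (\<Sum>j\<in>UNIV. ((y - x) $ j) ^ 4)))"
            using k by (intro mult_left_mono)
          then show ?thesis unfolding abs_k by (simp add: mult_ac)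
        qed
        ultimately show ?thesis using nn by linarith
      qed
    qed
    have int: "integrable lborel (\<lambda>y. k y * T y)"
      using kT by (simp add: has_bochner_integral_iff)
    have "(\<integral>y. k y * F y \<partial>lborel) - F x - b / 2 * (\<Sum>j\<in>UNIV. x $ j * H (axis j 1) (axis j 1))
        = (\<integral>y. k y * F y - k y * T y \<partial>lborel)"
      using kT kF by (simp add: has_bochner_integral_iff)
    also have "\<bar>\<dots>\<bar> \<le> (\<integral>y. \<epsilon> * (k y * (norm (y - x))\<^sup>2) + B b * \<bar>F y\<bar>
        + C * CARD('d) * (k y * (\<Sum>j\<in>UNIV. (y $ j - x $ j) ^ 4)) \<partial>lborel)"
      using bound kF int pointwise
      by (intro integral_abs_bound_integral Bochner_Integration.integrable_diff)
         (auto simp only: has_bochner_integral_iff)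
    also have "\<dots> = \<epsilon> * (b * S) + B b * I + C * CARD('d) * Q b"
      using bound by (simp add: has_bochner_integral_iff)
    finally show ?thesis unfolding k_def .
  qed

  have pos: "\<forall>\<^sub>F b in at_right 0. (0::real) < b" by (rule eventually_at_right_less)
  have small: "\<forall>\<^sub>F b in at_right 0. \<forall>j. b \<le> x $ j"
  proof (rule eventually_all_finite)
    show "\<forall>\<^sub>F b in at_right 0. b \<le> x $ j" for j
      unfolding eventually_at_right_field using x[of j] by (intro exI[of _ "x $ j"]) auto
  qed
  \<comment> \<open>B is a finite sum of exponentially small terms, while Q has order
    \<open>b\<^sup>2\<close>; both are therefore o(b).\<close>
  have "B \<in> o[at_right 0](\<lambda>b. b)"
    unfolding B_def[abs_def]
  proof (rule big_sum_in_smallo, rule inverse_power_times_exp_smallo)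
    show "0 < (min 1 (\<delta> / x $ j) / 3)\<^sup>2" for j
      using x[of j] \<delta> by (intro zero_less_power) simp
  qed (rule x)
  then have "(\<lambda>b. B b * I) \<in> o[at_right 0](\<lambda>b. b)"
    by (cases "I = 0") auto
  from landau_o.smallD[OF this, of "c / 3"] c
  have Bc: "\<forall>\<^sub>F b in at_right 0. \<bar>B b * I\<bar> \<le> c / 3 * \<bar>b\<bar>" by simp
  have "Q \<in> o[at_right 0](\<lambda>b. b)"
    unfolding Q_def[abs_def]
  proof (rule big_sum_in_smallo, rule smalloI_tendsto)
    fix j
    have "((\<lambda>b. 3 * (x $ j)\<^sup>2 * b + 6 * x $ j * b\<^sup>2) \<longlongrightarrow> 3 * (x $ j)\<^sup>2 * 0 + 6 * x $ j * 0\<^sup>2) (at_right 0)"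
      by (intro tendsto_intros)
    moreover have "\<forall>\<^sub>F b in at_right 0. 3 * (x $ j)\<^sup>2 * b + 6 * x $ j * b\<^sup>2
        = (3 * (x $ j)\<^sup>2 * b\<^sup>2 + 6 * x $ j * b ^ 3) / b"
      using pos by eventually_elim (simp add: field_simps eval_nat_numeral)
    ultimately show "((\<lambda>b. (3 * (x $ j)\<^sup>2 * b\<^sup>2 + 6 * x $ j * b ^ 3) / b) \<longlongrightarrow> 0) (at_right 0)"
      by (auto intro: Lim_transform_eventually)
    show "\<forall>\<^sub>F b in at_right 0. b \<noteq> (0::real)"
      using pos by eventually_elim simp
  qed
  then have "(\<lambda>b. C * CARD('d) * Q b) \<in> o[at_right 0](\<lambda>b. b)"
    by (cases "C = 0") auto
  from landau_o.smallD[OF this, of "c / 3"] c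
  have Qc: "\<forall>\<^sub>F b in at_right 0. \<bar>C * CARD('d) * Q b\<bar> \<le> c / 3 * \<bar>b\<bar>" by simp
  show "\<forall>\<^sub>F b in at_right 0. norm ((\<integral>y. prod_gamma_density x b y * F y \<partial>lborel) - F x
      - b / 2 * (\<Sum>j\<in>UNIV. x $ j * H (axis j 1) (axis j 1))) \<le> c * norm b"
    using pos small Bc Qc
  proof eventually_elim
    case (elim b)
    have "\<bar>(\<integral>y. prod_gamma_density x b y * F y \<partial>lborel) - F x
        - b / 2 * (\<Sum>j\<in>UNIV. x $ j * H (axis j 1) (axis j 1))\<bar>
        \<le> \<epsilon> * (b * S) + B b * I + C * CARD('d) * Q b"
      using elim(2) by (intro main[OF elim(1)]) blast
    also have "\<epsilon> * (b * S) = c / 3 * b" using S by (simp add: \<epsilon>_def)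
    also have "c / 3 * b + B b * I + C * CARD('d) * Q b \<le> c * b"
      using elim(1,3,4) by simp
    finally show ?case using elim(1) by simp
  qed
qed

subsection \<open>Reduction of the estimator to gamma smoothing\<close>

text \<open>Apply stationarity to the index set \<open>{0}\<close> with shift i and push forward
  under evaluation at 0.\<close>

lemma strictly_stationary_distr:
  assumes "strictly_stationary M X"
  shows "distr M borel (X i) = distr M borel (X 0)"
proof -
  have [measurable]: "X j \<in> borel_measurable M" for j
    using assms by (simp add: strictly_stationary_def)
  have "distr M (\<Pi>\<^sub>M k\<in>{0}. borel) (\<lambda>\<omega>. \<lambda>k\<in>{0}. X (k + i) \<omega>)
      = distr M (\<Pi>\<^sub>M k\<in>{0}. borel) (\<lambda>\<omega>. \<lambda>k\<in>{0}. X k \<omega>)"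
    using assms unfolding strictly_stationary_def by blast
  then have "distr (distr M (\<Pi>\<^sub>M k\<in>{0}. borel) (\<lambda>\<omega>. \<lambda>k\<in>{0}. X (k + i) \<omega>)) borel (\<lambda>w. w 0)
      = distr (distr M (\<Pi>\<^sub>M k\<in>{0}. borel) (\<lambda>\<omega>. \<lambda>k\<in>{0}. X k \<omega>)) borel (\<lambda>w. w 0)"
    by simp
  then show ?thesis
    by (subst (asm) (1 2) distr_distr) (auto simp: comp_def)
qed

text \<open>By linearity only the laws of the single observations matter, and stationarity makes
  them all equal to the law of \<open>X 0\<close>.\<close>

lemma expectation_gamma_kde:
  fixes X :: "nat \<Rightarrow> 'w \<Rightarrow> real ^ 'd" and F :: "real ^ 'd \<Rightarrow> real"
  assumes M: "prob_space M"
    and stat: "strictly_stationary M X"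
    and orth: "\<And>i \<omega>. \<omega> \<in> space M \<Longrightarrow> X i \<omega> \<in> nonneg_orthant"
    and dist: "distributed M lborel (X 0) (\<lambda>y. ennreal (F y))" and F: "\<And>y. 0 \<le> F y"
    and n: "0 < n" and b: "0 < b" "\<And>j. 2 * b \<le> x $ j"
  shows "prob_space.expectation M (gamma_kde X n b x) = (\<integral>y. prod_gamma_density x b y * F y \<partial>lborel)"
proof -
  interpret prob_space M by fact
  define k where "k = prod_gamma_density x b"
  have bx: "b \<le> x $ j" and x: "0 < x $ j" for j
    using b(1) b(2)[of j] by linarith+
  have [measurable]: "X i \<in> borel_measurable M" "k \<in> borel_measurable borel" for i
    using stat by (simp_all add: strictly_stationary_def k_def)
  have int: "integrable M (\<lambda>\<omega>. k (X i \<omega>))" for i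
    using prod_gamma_density_le_const[OF b(1) bx] prod_gamma_density_nonneg[OF x b(1)]
    by (intro integrable_const_bound[where B = "(exp 1 / b) ^ CARD('d)"]) (auto simp: k_def)
  have "expectation (\<lambda>\<omega>. k (X i \<omega>)) = (\<integral>y. k y \<partial>distr M borel (X i))" for i
    by (subst integral_distr) simp_all
  then have "expectation (\<lambda>\<omega>. k (X i \<omega>)) = expectation (\<lambda>\<omega>. k (X 0 \<omega>))" for i
    by (simp only: strictly_stationary_distr[OF stat, of i])
  also have "expectation (\<lambda>\<omega>. k (X 0 \<omega>)) = (\<integral>y. F y * k y \<partial>lborel)"
    using distributed_integral[OF dist, of k] F by simp
  finally have eq: "expectation (\<lambda>\<omega>. k (X i \<omega>)) = (\<integral>y. k y * F y \<partial>lborel)" for i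
    by (simp add: mult.commute)
  \<comment> \<open>Observations lie in the orthant, so the cut-off in \<open>gamma_density\<close>
    equals 1, and \<open>2 * b \<le> x $ j\<close> selects the branch \<open>x $ j / b\<close> of
    the shape.\<close>
  have "expectation (gamma_kde X n b x) = expectation (\<lambda>\<omega>. 1 / real n * (\<Sum>i<n. k (X i \<omega>)))"
  proof (rule Bochner_Integration.integral_cong)
    fix \<omega> assume "\<omega> \<in> space M"
    from orth[OF this] show "gamma_kde X n b x \<omega> = 1 / real n * (\<Sum>i<n. k (X i \<omega>))"
      using b by (simp add: gamma_kde_def k_def prod_gamma_density_def gamma_density_def
          gamma_shape_def nonneg_orthant_def)
  qed simp
  also have "\<dots> = 1 / real n * (\<Sum>i<n. expectation (\<lambda>\<omega>. k (X i \<omega>)))"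
    using int by (simp add: Bochner_Integration.integral_sum)
  also have "\<dots> = (\<integral>y. k y * F y \<partial>lborel)"
    using n by (simp add: eq)
  finally show ?thesis by (simp add: k_def)
qed

section \<open>From smoothing the extended density to the bias of the estimator\<close>

theorem lemma1:
  fixes M :: "'w measure"
    and X :: "nat \<Rightarrow> 'w \<Rightarrow> real ^ 'd"
    and f :: "real ^ 'd \<Rightarrow> real"
    and b :: "nat \<Rightarrow> real"
    and x :: "real ^ 'd"
  assumes "prob_space M"
    and "strictly_stationary M X"
    and "\<And>i \<omega>. \<omega> \<in> space M \<Longrightarrow> X i \<omega> \<in> nonneg_orthant"
    and "\<And>y. y \<in> nonneg_orthant \<Longrightarrow> 0 \<le> f y"
    and "distributed M lborel (X 0) (\<lambda>y. ennreal (f y) * indicator nonneg_orthant y)"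
    and "twice_cont_diff_on f nonneg_orthant"
    and "\<And>n. 0 < b n"
    and "b \<longlonglongrightarrow> 0"
    and "\<And>j. 0 < x $ j"
  shows "(\<lambda>n. (prob_space.expectation M (gamma_kde X n (b n) x) - f x)
             - b n / 2 * (\<Sum>j\<in>UNIV. x $ j * partial_deriv j (partial_deriv j f) x))
         \<in> o(\<lambda>n. b n)"
proof -
  interpret prob_space M by fact
  \<comment> \<open>The values of f outside the orthant are arbitrary, so f is replaced by its
    extension by 0. On the open set U both agree.\<close>
  define F where "F y = f y * indicator nonneg_orthant y" for y
  define U where "U = {y :: real ^ 'd. \<forall>j. 0 < y $ j}"
  have F_nonneg: "0 \<le> F y" for y
    using assms(4) by (simp add: F_def indicator_def)
  have "(\<lambda>y. ennreal (f y) * indicator nonneg_orthant y) = (\<lambda>y. ennreal (F y))"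
    by (auto simp: F_def indicator_def)
  with assms(5) have dist: "distributed M lborel (X 0) (\<lambda>y. ennreal (F y))" by simp
  \<comment> \<open>Integrability of F is integrability of the constant 1 under the law of
    \<open>X 0\<close>.\<close>
  have F_int: "integrable lborel F"
    using distributed_integrable[OF dist, of "\<lambda>_. 1"] F_nonneg by simp

  have "U = (\<Inter>j. {y. 0 < y $ j})"
    by (auto simp: U_def)
  moreover have "open {y :: real ^ 'd. 0 < y $ j}" for j
    by (intro open_Collect_less continuous_intros)
  ultimately have U: "open U" "x \<in> U" "U \<subseteq> nonneg_orthant"
    using assms(9) by (auto simp: U_def nonneg_orthant_def less_imp_le)
  obtain f' f'' where f': "\<And>y. y \<in> nonneg_orthant \<Longrightarrow> (f has_derivative blinfun_apply (f' y)) (at y within nonneg_orthant)"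
    and f'': "\<And>y. y \<in> nonneg_orthant \<Longrightarrow> (f' has_derivative blinfun_apply (f'' y)) (at y within nonneg_orthant)"
    using assms(6) unfolding twice_cont_diff_on_def by blast
  \<comment> \<open>At interior points the derivatives within the orthant are ordinary ones.\<close>
  have at: "at y within nonneg_orthant = at y" if "y \<in> U" for y
    using that U by (intro at_within_interior) (auto intro: interiorI)
  have D1: "(f has_derivative blinfun_apply (f' y)) (at y)" if "y \<in> U" for y
    using f'[of y] at[OF that] U that by auto
  have D2: "(f' has_derivative blinfun_apply (f'' x)) (at x)"
    using f''[of x] at[of x] U by auto
  have FU: "F y = f y" if "y \<in> U" for y
    using that U by (auto simp: F_def)
  have "\<exists>\<delta>>0. \<forall>y. norm (y - x) < \<delta> \<longrightarrow>
      \<bar>F y - (F x + f' x (y - x) + f'' x (y - x) (y - x) / 2)\<bar> \<le> \<epsilon> * (norm (y - x))\<^sup>2"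
    if "0 < \<epsilon>" for \<epsilon>
  proof (rule taylor_second_order_peano[OF U(1,2) _ D2 that])
    show "(F has_derivative blinfun_apply (f' y)) (at y)" if "y \<in> U" for y
      by (rule has_derivative_transform_within_open[OF D1[OF that] U(1) that]) (simp add: FU)
  qed
  from prod_gamma_smoothing_bias[OF assms(9) F_int this]
  have smooth: "(\<lambda>h. (\<integral>y. prod_gamma_density x h y * F y \<partial>lborel) - f x
      - h / 2 * (\<Sum>j\<in>UNIV. x $ j * f'' x (axis j 1) (axis j 1))) \<in> o[at_right 0](\<lambda>h. h)"
    using U by (simp add: FU)
  \<comment> \<open>Positivity of the bandwidths turns convergence to 0 into convergence from the
    right, so \<open>b n\<close> may be substituted into the one-sided estimate.\<close>
  have "b n \<noteq> 0" for n using assms(7)[of n] by simp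
  then have "filterlim b (at_right 0) sequentially"
    using assms(7,8) by (simp add: filterlim_at)
  note lim = landau_o.small.compose[OF smooth this]
  \<comment> \<open>The threshold \<open>x $ j / 2\<close> yields
    \<open>2 * b n \<le> x $ j\<close>. The index n = 0 is also excluded below, since there
    \<open>1 / real n = 0\<close>; equality from some index on suffices for a Landau class.\<close>
  have "\<forall>\<^sub>F n in sequentially. \<forall>j. b n < x $ j / 2"
    using assms(8,9) by (intro eventually_all_finite) (auto intro!: order_tendstoD(2))
  then have "\<forall>\<^sub>F n in sequentially.
      (\<integral>y. prod_gamma_density x (b n) y * F y \<partial>lborel) - f x
        - b n / 2 * (\<Sum>j\<in>UNIV. x $ j * f'' x (axis j 1) (axis j 1))
      = (expectation (gamma_kde X n (b n) x) - f x)
        - b n / 2 * (\<Sum>j\<in>UNIV. x $ j * partial_deriv j (partial_deriv j f) x)"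
    using eventually_gt_at_top[of 0]
  proof eventually_elim
    case (elim n)
    have "2 * b n \<le> x $ j" for j using elim(1) by (simp add: less_imp_le field_simps)
    from expectation_gamma_kde[OF assms(1-3) dist F_nonneg elim(2) assms(7) this]
    show ?case
      by (simp add: partial_deriv_partial_deriv_eq[OF U(1,2) D1 D2])
  qed
  then show ?thesis using lim by (rule landau_o.small.in_cong[THEN iffD1])
qed

end
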